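(* For all integers $n\geq 1$ and $0\leq j\leq n$, we have $|B_n^j(1234)|=|B_n^j(2143)|$.
   Context: The signed permutation group $B_n$ consists of the permutations $w$ of $\{-n,\ldots,-1,1,\ldots,n\}$ such that $w(-i)=-w(i)$ for all $i$. Identify $w$ with a permutation in $S_{2n}$ by listing $w(-n),w(-n+1),\ldots,w(-1),w(1),\ldots,w(n)$ and standardizing values (the natural order on $\{-n,\ldots,-1,1,\ldots,n\}$). We say $w\in B_n$ avoids a pattern $\pi\in S_k$ if this associated permutation in $S_{2n}$ avoids $\pi$ in the classical sense. Concretely, $w$ avoids $1234$ iff there are no $-n\leq a<b<c<d\leq n$ (indices nonzero) with $w(a)<w(b)<w(c)<w(d)$, and $w$ avoids $2143$ iff there are no such $a<b<c<d$ with $w(b)<w(a)<w(d)<w(c)$. Let $B_n(\pi)$ be the set of $w\in B_n$ avoiding $\pi$, and for $0\le j\le n$ let $B_n^j(\pi)$ be the set of $w\in B_n(\pi)$ such that $w(i)>0$ for exactly $j$ indices $i\in\{1,\ldots,n\}$. *)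

theory Defs
  imports Main
begin

definition signed_dom :: "nat \<Rightarrow> int set" where
  "signed_dom n = {- int n .. int n} - {0}"

definition signed_perms :: "nat \<Rightarrow> (int \<Rightarrow> int) set" where
  "signed_perms n = {w. bij_betw w (signed_dom n) (signed_dom n)
      \<and> (\<forall>i\<in>signed_dom n. w (- i) = - w i)
      \<and> (\<forall>i. i \<notin> signed_dom n \<longrightarrow> w i = i)}"

text \<open>Classical pattern containment of a pattern pi (a permutation of 1..k given
  as a list) in w restricted to the linearly ordered position set S: there are
  positions idx 0 < ... < idx (k-1) in S whose values are order-isomorphic to pi.
  Since standardization preserves relative order, this is containment of pi in
  the associated permutation of S_{2n}.\<close>
definition contains_pattern :: "int set \<Rightarrow> (int \<Rightarrow> int) \<Rightarrow> nat list \<Rightarrow> bool" where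
  "contains_pattern S w pi \<longleftrightarrow> (\<exists>idx :: nat \<Rightarrow> int.
      (\<forall>i < length pi. idx i \<in> S)
    \<and> (\<forall>i j. i < j \<and> j < length pi \<longrightarrow> idx i < idx j)
    \<and> (\<forall>i < length pi. \<forall>j < length pi. (w (idx i) < w (idx j) \<longleftrightarrow> pi ! i < pi ! j)))"

definition B_avoid :: "nat \<Rightarrow> nat list \<Rightarrow> (int \<Rightarrow> int) set" where
  "B_avoid n pi = {w \<in> signed_perms n. \<not> contains_pattern (signed_dom n) w pi}"

definition B_avoid_j :: "nat \<Rightarrow> nat \<Rightarrow> nat list \<Rightarrow> (int \<Rightarrow> int) set" where
  "B_avoid_j n j pi = {w \<in> B_avoid n pi. card {i \<in> {1 .. int n}. w i > 0} = j}"

end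

theory Submission
  imports Defs "HOL-Combinatorics.Transposition"
begin

text \<open>Draw the graph of \<open>w\<close> as a centrally symmetric set of points in four quadrants. If \<open>w\<close> avoids
  1234 (or 2143), then the points in the lower left quadrant are decreasing (or increasing), since an
  ascent (or descent) there would form a forbidden pattern with its mirror image. Hence \<open>w\<close> is determined by its
  upper left quadrant, which we record by discarding the lower right quadrant, squeezing the lower
  left one into row 0 and the upper right one into column 0. Every occurrence of the pattern in \<open>w\<close>,
  or its mirror image, misses the lower right quadrant, and it remains visible as an occurrence
  with strict inequalities in the squeezed diagram.

  The squeezed diagrams carry no symmetry any more, so the two halves of the pattern can be
  reversed one after the other, as in the argument of Backelin, West and Xin: the cells to the lower
  left of an occurrence of the upper half form a Ferrers board, and among the diagrams that differ
  only by rearrangements on this board exactly one avoids 12 and exactly one avoids 21 there.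
  Reflection in the antidiagonal interchanges the two halves.\<close>

section \<open>Fillings and Ferrers boards\<close>

text \<open>The relations \<open>r\<close> and \<open>s\<close> describe the lower left and the
  upper right half of the pattern and can be changed independently: \<open>(<) (<)\<close> is 1234,
  \<open>(>) (>)\<close> is 2143, and the mixed choices are 2134 and 1243. For these relations all
  inequalities are strict, so two points sharing a row or a column never take part in the same
  occurrence, which matters once row 0 and column 0 hold several points.\<close>

definition split_pattern ::
    "(int \<Rightarrow> int \<Rightarrow> bool) \<Rightarrow> (int \<Rightarrow> int \<Rightarrow> bool) \<Rightarrow> (int \<times> int) set \<Rightarrow> bool" where
  "split_pattern r s M \<longleftrightarrow> (\<exists>a \<alpha> b \<beta> c \<gamma> d \<delta>.
      (a, \<alpha>) \<in> M \<and> (b, \<beta>) \<in> M \<and> (c, \<gamma>) \<in> M \<and> (d, \<delta>) \<in> M \<and> a < b \<and> b < c \<and> c < d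
      \<and> r \<alpha> \<beta> \<and> s \<gamma> \<delta> \<and> max \<alpha> \<beta> < min \<gamma> \<delta>)"

text \<open>Row 0 and column 0 stand for the squeezed quadrants, which are mirror images of each
  other and hence both hold \<open>j\<close> points. The cell \<open>(0, 0)\<close> is where points
  of the discarded lower right quadrant would land.\<close>

definition fillings :: "nat \<Rightarrow> nat \<Rightarrow> (int \<times> int) set set" where
  "fillings n j = {M. M \<subseteq> {- int n..0} \<times> {0..int n} - {(0, 0)}
      \<and> (\<forall>x\<in>{- int n..0}. card {y. (x, y) \<in> M} = (if x = 0 then j else 1))
      \<and> (\<forall>y\<in>{0..int n}. card {x. (x, y) \<in> M} = (if y = 0 then j else 1))}"

lemma fillings_subset: "M \<in> fillings n j \<Longrightarrow> M \<subseteq> {- int n..0} \<times> {0..int n}"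
  by (auto simp: fillings_def)

lemma fillings_bounds:
  "M \<in> fillings n j \<Longrightarrow> (x, y) \<in> M \<Longrightarrow> - int n \<le> x \<and> x \<le> 0 \<and> 0 \<le> y \<and> y \<le> int n"
  by (auto simp: fillings_def)

lemma fillings_origin: "M \<in> fillings n j \<Longrightarrow> (0, 0) \<notin> M"
  by (auto simp: fillings_def)

lemma finite_filling: "M \<in> fillings n j \<Longrightarrow> finite M"
  using fillings_subset finite_subset by (metis finite_SigmaI finite_atLeastAtMost_int)

lemma finite_fillings: "finite (fillings n j)"
proof (rule finite_subset)
  show "fillings n j \<subseteq> Pow ({- int n..0} \<times> {0..int n})"
    using fillings_subset by blast
qed simp

lemma fillings_column:
  assumes "M \<in> fillings n j" "x \<in> {- int n..0}" "x \<noteq> 0"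
  shows "\<exists>!y. (x, y) \<in> M"
proof -
  have "card {y. (x, y) \<in> M} = 1"
    using assms by (auto simp: fillings_def)
  then show ?thesis
    by (auto simp: card_1_singleton_iff set_eq_iff)
qed

lemma fillings_row:
  assumes "M \<in> fillings n j" "y \<in> {0..int n}" "y \<noteq> 0"
  shows "\<exists>!x. (x, y) \<in> M"
proof -
  have "card {x. (x, y) \<in> M} = 1"
    using assms by (auto simp: fillings_def)
  then show ?thesis
    by (auto simp: card_1_singleton_iff set_eq_iff)
qed

lemma fillings_row_card_eq:
  assumes "M \<in> fillings n j" "M' \<in> fillings n j"
  shows "card {x. (x, y) \<in> M} = card {x. (x, y) \<in> M'}"
proof (cases "y \<in> {0..int n}")
  case True
  then show ?thesis using assms by (simp add: fillings_def)
next
  case False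
  then have "{x. (x, y) \<in> M} = {}" "{x. (x, y) \<in> M'} = {}"
    using assms fillings_bounds by fastforce+
  then show ?thesis by simp
qed

lemma fillings_row_exchange:
  assumes M: "M \<in> fillings n j" and M': "M' \<in> fillings n j"
    and x: "(x, y) \<in> M" "(x, y) \<notin> M'"
  shows "\<exists>z. (z, y) \<in> M' \<and> (z, y) \<notin> M"
proof (rule ccontr)
  assume "\<not> ?thesis"
  then have "{z. (z, y) \<in> M'} \<subset> {z. (z, y) \<in> M}"
    using x by blast
  moreover have "finite {z. (z, y) \<in> M}"
    using finite_subset[of "{z. (z, y) \<in> M}" "fst ` M"] finite_filling[OF M] by force
  ultimately show False
    using psubset_card_mono fillings_row_card_eq[OF M M'] by (metis less_irrefl)
qed

text \<open>The cells in which the lower left half of a pattern may be rearranged: those lying strictly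
  below and to the left of an occurrence of the upper right half. Row 0 is added so that the zeros
  can be moved as well.\<close>

definition board :: "(int \<Rightarrow> int \<Rightarrow> bool) \<Rightarrow> (int \<times> int) set \<Rightarrow> (int \<times> int) set" where
  "board s M = {(x, y). y \<le> 0 \<or> (\<exists>c \<gamma> d \<delta>. (c, \<gamma>) \<in> M \<and> (d, \<delta>) \<in> M \<and> x < c \<and> c < d
      \<and> s \<gamma> \<delta> \<and> y < min \<gamma> \<delta>)}"

lemma boardI:
  "(c, \<gamma>) \<in> M \<Longrightarrow> (d, \<delta>) \<in> M \<Longrightarrow> x < c \<Longrightarrow> c < d \<Longrightarrow> s \<gamma> \<delta> \<Longrightarrow> y < min \<gamma> \<delta> \<Longrightarrow> (x, y) \<in> board s M"
  unfolding board_def by blast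

lemma boardE:
  assumes "(x, y) \<in> board s M" "y > 0"
  obtains c \<gamma> d \<delta> where "(c, \<gamma>) \<in> M" "(d, \<delta>) \<in> M" "x < c" "c < d" "s \<gamma> \<delta>" "y < min \<gamma> \<delta>"
  using assms unfolding board_def by force

lemma board_downset:
  assumes xy: "(x, y) \<in> board s M" and "x' \<le> x" "y' \<le> y"
  shows "(x', y') \<in> board s M"
proof (cases "y > 0")
  case True
  from xy this show ?thesis
  proof (rule boardE)
    fix c \<gamma> d \<delta>
    assume "(c, \<gamma>) \<in> M" "(d, \<delta>) \<in> M" "x < c" "c < d" "s \<gamma> \<delta>" "y < min \<gamma> \<delta>"
    with assms(2,3) show ?thesis by (intro boardI[of c \<gamma> M d \<delta>]) auto
  qed
next
  case False
  with assms(3) show ?thesis by (simp add: board_def)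
qed

text \<open>The points off the board already determine the board. For a cell above row 0, choose the
  witnessing pair whose left point is as far right as possible. Both points of this pair lie off the
  board, as otherwise a witness further to the right would exist, so the pair survives in
  \<open>M'\<close>. Conversely, if a pair in \<open>M'\<close> witnesses a cell, then either one of
  its points is on the board of \<open>M\<close>, which is closed to the lower left, or both points
  belong to \<open>M\<close>.\<close>

lemma board_cong:
  assumes "finite M" and eq: "M - board s M = M' - board s M"
  shows "board s M' = board s M"
proof (intro set_eqI iffI; clarify)
  fix x y assume xy: "(x, y) \<in> board s M'"
  show "(x, y) \<in> board s M"
  proof (cases "y > 0")
    case False
    then show ?thesis by (simp add: board_def)
  next
    case True
    obtain c \<gamma> d \<delta> where p: "(c, \<gamma>) \<in> M'" "(d, \<delta>) \<in> M'" "x < c" "c < d" "s \<gamma> \<delta>" "y < min \<gamma> \<delta>"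
      using xy True by (rule boardE)
    show ?thesis
    proof (cases "(c, \<gamma>) \<in> board s M \<or> (d, \<delta>) \<in> board s M")
      case True
      then show ?thesis using board_downset[of _ _ s M x y] p by fastforce
    next
      case False
      then have "(c, \<gamma>) \<in> M" "(d, \<delta>) \<in> M" using p eq by blast+
      then show ?thesis using p boardI by blast
    qed
  qed
next
  fix x y assume xy: "(x, y) \<in> board s M"
  show "(x, y) \<in> board s M'"
  proof (cases "y > 0")
    case False
    then show ?thesis by (simp add: board_def)
  next
    case y: True
    define P where "P = {c. \<exists>\<gamma> d \<delta>. (c, \<gamma>) \<in> M \<and> (d, \<delta>) \<in> M \<and> x < c \<and> c < d
      \<and> s \<gamma> \<delta> \<and> y < min \<gamma> \<delta>}"
    have "P \<subseteq> fst ` M" unfolding P_def by force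
    then have "finite P" using \<open>finite M\<close> finite_subset by blast
    moreover have "P \<noteq> {}"
      using xy y
    proof (rule boardE)
      fix c \<gamma> d \<delta>
      assume "(c, \<gamma>) \<in> M" "(d, \<delta>) \<in> M" "x < c" "c < d" "s \<gamma> \<delta>" "y < min \<gamma> \<delta>"
      then have "c \<in> P" unfolding P_def by blast
      then show ?thesis by blast
    qed
    ultimately have "Max P \<in> P" and max: "\<And>c. c \<in> P \<Longrightarrow> c \<le> Max P" by auto
    then obtain \<gamma> d \<delta> where p: "(Max P, \<gamma>) \<in> M" "(d, \<delta>) \<in> M" "x < Max P" "Max P < d" "s \<gamma> \<delta>"
      "y < min \<gamma> \<delta>" unfolding P_def by blast
    have out: "(u, v) \<notin> board s M" if "Max P \<le> u" "y < v" for u v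
    proof
      assume "(u, v) \<in> board s M"
      moreover have "v > 0" using that y by simp
      ultimately obtain c' \<gamma>' d' \<delta>' where q: "(c', \<gamma>') \<in> M" "(d', \<delta>') \<in> M" "u < c'" "c' < d'"
        "s \<gamma>' \<delta>'" "v < min \<gamma>' \<delta>'" by (rule boardE)
      then have "c' \<in> P" using p that unfolding P_def by force
      then show False using max q that by force
    qed
    have "(Max P, \<gamma>) \<in> M'" "(d, \<delta>) \<in> M'" using p eq out[of "Max P" \<gamma>] out[of d \<delta>] by auto
    then show ?thesis using p boardI by blast
  qed
qed

text \<open>Whether a lower pair extends to an occurrence depends only on its upper right corner
  \<open>(b, max \<alpha> \<beta>)\<close>. Positivity is required because the cells with
  \<open>y \<le> 0\<close> are on the board by convention, without a witness.\<close>

lemma split_pattern_boardI: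
  assumes "(a, \<alpha>) \<in> M" "(b, \<beta>) \<in> M" "a < b" "r \<alpha> \<beta>" "max \<alpha> \<beta> > 0" "(b, max \<alpha> \<beta>) \<in> board s M"
  shows "split_pattern r s M"
  using assms(6,5)
proof (rule boardE)
  fix c \<gamma> d \<delta>
  assume "(c, \<gamma>) \<in> M" "(d, \<delta>) \<in> M" "b < c" "c < d" "s \<gamma> \<delta>" "max \<alpha> \<beta> < min \<gamma> \<delta>"
  with assms(1-4) show ?thesis unfolding split_pattern_def by blast
qed

lemma split_pattern_boardE:
  assumes "split_pattern r s M"
  obtains a \<alpha> b \<beta> where "(a, \<alpha>) \<in> M" "(b, \<beta>) \<in> M" "a < b" "r \<alpha> \<beta>" "(b, max \<alpha> \<beta>) \<in> board s M"
proof -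
  obtain a \<alpha> b \<beta> c \<gamma> d \<delta> where *: "(a, \<alpha>) \<in> M" "(b, \<beta>) \<in> M" "(c, \<gamma>) \<in> M" "(d, \<delta>) \<in> M"
    "a < b" "b < c" "c < d" "r \<alpha> \<beta>" "s \<gamma> \<delta>" "max \<alpha> \<beta> < min \<gamma> \<delta>"
    using assms unfolding split_pattern_def by blast
  then have "(b, max \<alpha> \<beta>) \<in> board s M" using boardI[of c \<gamma> M d \<delta> b s "max \<alpha> \<beta>"] by blast
  with * show thesis using that by blast
qed

section \<open>Exchanging two columns of a filling\<close>

definition switch :: "int \<Rightarrow> int \<Rightarrow> (int \<times> int) set \<Rightarrow> (int \<times> int) set" where
  "switch a b M = {(x, y). (transpose a b x, y) \<in> M}"

lemma switch_eq_image: "switch a b M = map_prod (transpose a b) id ` M"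
proof (intro set_eqI iffI; clarify)
  fix x y assume "(x, y) \<in> switch a b M"
  then have "(transpose a b x, y) \<in> M" by (simp add: switch_def)
  then show "(x, y) \<in> map_prod (transpose a b) id ` M"
    by (rule rev_image_eqI) simp
qed (auto simp: switch_def)

text \<open>Column 0, which holds \<open>j\<close> points, stays in place, and the exchanged columns
  hold one point each. The points of each row are only permuted.\<close>

lemma switch_fillings:
  assumes M: "M \<in> fillings n j" and ab: "a \<in> {- int n..-1}" "b \<in> {- int n..-1}"
  shows "switch a b M \<in> fillings n j"
proof -
  have dom: "transpose a b x \<in> {- int n..0} \<longleftrightarrow> x \<in> {- int n..0}" for x
    using ab by (auto simp: transpose_def)
  have z: "transpose a b x = 0 \<longleftrightarrow> x = 0" for x
    using ab by (auto simp: transpose_def)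
  have sub: "switch a b M \<subseteq> {- int n..0} \<times> {0..int n} - {(0, 0)}"
  proof clarify
    fix x y assume "(x, y) \<in> switch a b M"
    then have "(transpose a b x, y) \<in> M" by (simp add: switch_def)
    then show "(x, y) \<in> {- int n..0} \<times> {0..int n} - {(0, 0)}"
      using M fillings_subset[OF M] fillings_origin[OF M] dom[of x] z[of x] by auto
  qed
  have row: "card {x. (x, y) \<in> switch a b M} = card {x. (x, y) \<in> M}" for y
  proof -
    have "{x. (x, y) \<in> switch a b M} = transpose a b ` {x. (x, y) \<in> M}"
      by (force simp: switch_eq_image)
    moreover have "inj_on (transpose a b) {x. (x, y) \<in> M}"
      by (rule inj_on_subset[OF inj_transpose]) simp
    ultimately show ?thesis by (metis card_image)
  qed
  have col: "card {y. (x, y) \<in> switch a b M} = card {y. (transpose a b x, y) \<in> M}" for x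
    by (simp add: switch_def)
  show ?thesis
    using sub M unfolding fillings_def mem_Collect_eq row col by (metis dom z)
qed

text \<open>The exchange affects only the four cells in columns \<open>a\<close>, \<open>b\<close>
  and rows \<open>\<alpha>\<close>, \<open>\<beta>\<close>. All of them lie weakly to the lower left
  of the corner \<open>(b, max \<alpha> \<beta>)\<close>, hence on the board.\<close>

lemma switch_outside:
  assumes M: "M \<in> fillings n j"
    and ab: "(a, \<alpha>) \<in> M" "(b, \<beta>) \<in> M" "a < b" "b < 0" and board: "(b, max \<alpha> \<beta>) \<in> board s M"
  shows "switch a b M - board s M = M - board s M"
proof -
  have bnd: "a \<in> {- int n..0}" "b \<in> {- int n..0}" "a \<noteq> 0" "b \<noteq> 0"
    using ab(3,4) fillings_bounds[OF M ab(1)] by auto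
  have ua: "y = \<alpha>" if "(a, y) \<in> M" for y
    using fillings_column[OF M bnd(1,3)] ab that by blast
  have ub: "y = \<beta>" if "(b, y) \<in> M" for y
    using fillings_column[OF M bnd(2,4)] ab that by blast
  have in_b: "(x, y) \<in> board s M" if "x \<le> b" "y = \<alpha> \<or> y = \<beta>" for x y
    using board_downset[OF board] that by auto
  have "(x, y) \<in> board s M \<or> ((x, y) \<in> switch a b M \<longleftrightarrow> (x, y) \<in> M)" for x y
  proof (cases "x = a \<or> x = b")
    case True
    show ?thesis
    proof (cases "y = \<alpha> \<or> y = \<beta>")
      case True
      then show ?thesis using in_b[of x y] \<open>x = a \<or> x = b\<close> ab(3) by auto
    next
      case False
      then have "(a, y) \<notin> M" "(b, y) \<notin> M" using ua ub by blast+
      then show ?thesis using \<open>x = a \<or> x = b\<close> by (auto simp: switch_def)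
    qed
  qed (simp add: switch_def)
  then show ?thesis by (simp add: set_eq_iff) blast
qed

text \<open>A potential function for column exchanges, as in the rearrangement inequality: its
  change has the sign of \<open>\<alpha> - \<beta>\<close>.\<close>

definition weight :: "(int \<times> int) set \<Rightarrow> int" where
  "weight M = (\<Sum>(x, y)\<in>M. x * y)"

lemma weight_switch:
  assumes M: "M \<in> fillings n j"
    and ab: "(a, \<alpha>) \<in> M" "(b, \<beta>) \<in> M" "a < b" "b < 0"
  shows "weight (switch a b M) = weight M + (b - a) * (\<alpha> - \<beta>)"
proof -
  have bnd: "a \<in> {- int n..0}" "b \<in> {- int n..0}" "a \<noteq> 0" "b \<noteq> 0"
    using ab(3,4) fillings_bounds[OF M ab(1)] by auto
  have ua: "y = \<alpha>" if "(a, y) \<in> M" for y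
    using fillings_column[OF M bnd(1,3)] ab that by blast
  have ub: "y = \<beta>" if "(b, y) \<in> M" for y
    using fillings_column[OF M bnd(2,4)] ab that by blast
  have fin: "finite M" using finite_filling[OF M] .
  have "inj_on (map_prod (transpose a b) id) M"
    by (auto intro!: inj_onI dest: injD[OF inj_transpose])
  then have "weight (switch a b M) = (\<Sum>(x, y)\<in>M. transpose a b x * y)"
    by (simp add: weight_def switch_eq_image sum.reindex case_prod_unfold)
  then have "weight (switch a b M) - weight M = (\<Sum>(x, y)\<in>M. (transpose a b x - x) * y)"
    by (simp add: weight_def case_prod_unfold left_diff_distrib sum_subtractf)
  also have "\<dots> = (\<Sum>(x, y)\<in>{(a, \<alpha>), (b, \<beta>)}. (transpose a b x - x) * y)"
  proof (rule sum.mono_neutral_right[OF fin])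
    show "{(a, \<alpha>), (b, \<beta>)} \<subseteq> M" using ab by simp
    show "\<forall>p\<in>M - {(a, \<alpha>), (b, \<beta>)}. (case p of (x, y) \<Rightarrow> (transpose a b x - x) * y) = 0"
      using ua ub by (auto simp: transpose_def split: if_splits)
  qed
  also have "\<dots> = (b - a) * \<alpha> + (a - b) * \<beta>"
    using ab by simp
  also have "\<dots> = (b - a) * (\<alpha> - \<beta>)" by (simp add: algebra_simps)
  finally show ?thesis by simp
qed

text \<open>Fillings with the same frozen part differ only by rearranging the entries on their common
  board.\<close>

definition frozen_part :: "(int \<Rightarrow> int \<Rightarrow> bool) \<Rightarrow> (int \<times> int) set \<Rightarrow> (int \<times> int) set \<times> (int \<times> int) set"
  where "frozen_part s M = (M - board s M, board s M)"

text \<open>Exchanging the columns of the lower half of an occurrence changes cells on the board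
  only, and by \<open>board_cong\<close> the board itself stays the same. So the exchange never
  leaves the finite class of fillings with the given frozen part.\<close>

lemma exists_avoider:
  assumes M: "M \<in> fillings n j" and r: "r = (<) \<or> r = (>)"
  shows "\<exists>M'\<in>fillings n j. \<not> split_pattern r s M' \<and> frozen_part s M' = frozen_part s M"
proof -
  define K where "K = {M' \<in> fillings n j. frozen_part s M' = frozen_part s M}"
  \<comment> \<open>Replacing an ascent on the board by a descent lowers the weight, so an extremal filling of the
    class has none.\<close>
  define m where "m M' = (if r 0 1 then weight M' else - weight M')" for M'
  have "finite K" "K \<noteq> {}" using M finite_fillings[of n j] by (auto simp: K_def)
  then obtain M' where M': "M' \<in> K" and min: "\<And>N. N \<in> K \<Longrightarrow> m M' \<le> m N"
    using arg_min_if_finite[of K m] by (metis not_le)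
  have fill: "M' \<in> fillings n j" using M' by (simp add: K_def)
  have "\<not> split_pattern r s M'"
  proof
    assume "split_pattern r s M'"
    then obtain a \<alpha> b \<beta> where ab: "(a, \<alpha>) \<in> M'" "(b, \<beta>) \<in> M'" "a < b" "r \<alpha> \<beta>"
      and board: "(b, max \<alpha> \<beta>) \<in> board s M'"
      by (rule split_pattern_boardE)
    have "\<alpha> \<noteq> \<beta>" using ab r by auto
    then have pos: "max \<alpha> \<beta> > 0"
      using fillings_bounds[OF fill ab(1)] fillings_bounds[OF fill ab(2)] by linarith
    \<comment> \<open>The corner is above row 0, so its place on the board is due to a genuine
      witness to the right of column \<open>b\<close>; hence column 0 takes no part in the
      exchange.\<close>
    have "b < 0"
      using board pos
    proof (rule boardE)
      fix c \<gamma> assume "(c, \<gamma>) \<in> M'" "b < c"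
      then show "b < 0" using fillings_bounds[OF fill, of c \<gamma>] by simp
    qed
    have "a \<in> {- int n..-1}" "b \<in> {- int n..-1}"
      using ab(3) \<open>b < 0\<close> fillings_bounds[OF fill ab(1)] by auto
    then have N: "switch a b M' \<in> fillings n j" using switch_fillings[OF fill] by blast
    have out: "switch a b M' - board s M' = M' - board s M'"
      using switch_outside[OF fill ab(1-3) \<open>b < 0\<close> board] .
    then have "board s (switch a b M') = board s M'"
      using board_cong[OF finite_filling[OF fill]] by metis
    then have "frozen_part s (switch a b M') = frozen_part s M'"
      using out by (simp add: frozen_part_def)
    then have "switch a b M' \<in> K" using N M' by (simp add: K_def)
    then have "m M' \<le> m (switch a b M')" by (rule min)
    moreover have "weight (switch a b M') = weight M' + (b - a) * (\<alpha> - \<beta>)"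
      using weight_switch[OF fill ab(1-3) \<open>b < 0\<close>] .
    moreover have "if r 0 1 then (b - a) * (\<alpha> - \<beta>) < 0 else (b - a) * (\<alpha> - \<beta>) > 0"
      using r ab(3,4) by (auto simp: mult_less_0_iff zero_less_mult_iff)
    ultimately show False by (simp add: m_def split: if_splits)
  qed
  then show ?thesis using M' by (auto simp: K_def)
qed

text \<open>Two different avoiders are compared in the last column \<open>x\<close> where they
  differ. Cells where they disagree are on the common board; for either choice of \<open>r\<close>,
  the cell \<open>(x, y')\<close> with the larger of the two entries is the corner of a forbidden
  pair in one of the fillings.\<close>

lemma avoider_unique:
  assumes M: "M \<in> fillings n j" "\<not> split_pattern r s M"
    and M': "M' \<in> fillings n j" "\<not> split_pattern r s M'"
    and r: "r = (<) \<or> r = (>)" and eq: "frozen_part s M = frozen_part s M'"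
  shows "M = M'"
proof (rule ccontr)
  assume "M \<noteq> M'"
  define X where "X = {x. \<exists>y. ((x, y) \<in> M) \<noteq> ((x, y) \<in> M')}"
  have "X \<subseteq> fst ` (M \<union> M')" unfolding X_def by force
  moreover have "finite (fst ` (M \<union> M'))"
    using finite_filling[OF M(1)] finite_filling[OF M'(1)] by simp
  ultimately have "finite X" by (rule finite_subset)
  moreover have "X \<noteq> {}" using \<open>M \<noteq> M'\<close> unfolding X_def by auto
  ultimately have "Max X \<in> X" and max: "\<And>x. x \<in> X \<Longrightarrow> x \<le> Max X" by auto
  have beq: "board s M = board s M'" using eq by (simp add: frozen_part_def)
  have agree: "(x, y) \<in> M \<longleftrightarrow> (x, y) \<in> M'" if "(x, y) \<notin> board s M" for x y
    using eq that unfolding frozen_part_def by auto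
  define x where "x = Max X"
  \<comment> \<open>In the last column \<open>x\<close> where the two fillings differ, the entry of either filling occurs further
    to the left in the other one: \<open>z\<close> gives an ascent in \<open>N'\<close> and \<open>z'\<close> a descent in \<open>N\<close>.\<close>
  have *: False
    if N: "N \<in> fillings n j" "\<not> split_pattern r s N" and N': "N' \<in> fillings n j" "\<not> split_pattern r s N'"
      and xy: "(x, y) \<in> N" "(x, y') \<in> N'" "y < y'" "(x, y') \<notin> N" "(x, y) \<notin> N'" "(x, y') \<in> board s N"
      and beq: "board s N = board s N'"
      and agr: "\<And>x' y. x < x' \<Longrightarrow> (x', y) \<in> N \<longleftrightarrow> (x', y) \<in> N'" for N N' y y'
  proof -
    have pos: "y' > 0" using xy(3) fillings_bounds[OF N(1) xy(1)] by simp
    obtain z where z: "(z, y) \<in> N'" "(z, y) \<notin> N"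
      using fillings_row_exchange[OF N(1) N'(1)] xy by blast
    obtain z' where z': "(z', y') \<in> N" "(z', y') \<notin> N'"
      using fillings_row_exchange[OF N'(1) N(1)] xy by blast
    have "z < x" "z' < x" using z z' xy agr by (metis linorder_neqE_linordered_idom)+
    from r show False
    proof
      assume "r = (<)"
      then show False using split_pattern_boardI[of z y N' x y' r s] z \<open>z < x\<close> xy beq pos N' by simp
    next
      assume "r = (>)"
      then show False using split_pattern_boardI[of z' y' N x y r s] z' \<open>z' < x\<close> xy beq pos N by simp
    qed
  qed
  obtain y0 where y0: "((x, y0) \<in> M) \<noteq> ((x, y0) \<in> M')"
    using \<open>Max X \<in> X\<close> unfolding X_def x_def by blast
  then have x_dom: "x \<in> {- int n..0}" 
    using fillings_bounds[OF M(1), of x y0] fillings_bounds[OF M'(1), of x y0] by auto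
  \<comment> \<open>No point lies to the right of column 0, so above row 0 this column contains no
    board cell, and \<open>(0, 0)\<close> is empty in both fillings: column 0 is frozen.\<close>
  have "x \<noteq> 0"
  proof
    assume "x = 0"
    then have "(0, y0) \<in> board s M" using y0 agree by blast
    moreover have "y0 > 0"
      using y0 \<open>x = 0\<close> fillings_bounds[OF M(1), of 0 y0] fillings_bounds[OF M'(1), of 0 y0]
        fillings_origin[OF M(1)] fillings_origin[OF M'(1)] by (metis order_le_less)
    ultimately show False
    proof (rule boardE)
      fix c \<gamma> assume "(c, \<gamma>) \<in> M" "0 < c"
      then show False using fillings_bounds[OF M(1), of c \<gamma>] by simp
    qed
  qed
  obtain y where y: "(x, y) \<in> M" "\<And>u. (x, u) \<in> M \<Longrightarrow> u = y"
    using fillings_column[OF M(1) x_dom \<open>x \<noteq> 0\<close>] by blast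
  obtain y' where y': "(x, y') \<in> M'" "\<And>u. (x, u) \<in> M' \<Longrightarrow> u = y'"
    using fillings_column[OF M'(1) x_dom \<open>x \<noteq> 0\<close>] by blast
  have ne: "y \<noteq> y'" using y0 y y' by metis
  then have nm: "(x, y') \<notin> M" "(x, y) \<notin> M'" using y y' by metis+
  have agr: "(x', v) \<in> M \<longleftrightarrow> (x', v) \<in> M'" if "x < x'" for x' v
    using max[of x'] that unfolding X_def x_def by fastforce
  have in_board: "(x, y) \<in> board s M" "(x, y') \<in> board s M" using agree nm y(1) y'(1) by blast+
  show False
  proof (cases "y < y'")
    case True
    show False by (rule *[OF M M' y(1) y'(1) True nm in_board(2) beq agr])
  next
    case False
    then have "y' < y" using ne by simp
    then show False
      using *[OF M' M y'(1) y(1) _ nm(2,1) _ beq[symmetric] agr[symmetric]] in_board(1) beq by simp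
  qed
qed

text \<open>Each class of fillings with equal frozen part contains exactly one avoider, so avoiders
  are counted by classes. The right-hand side is independent of \<open>r\<close>, which allows the
  lower half of the pattern to be replaced.\<close>

lemma card_avoiders_frozen_parts:
  assumes "r = (<) \<or> r = (>)"
  shows "card {M \<in> fillings n j. \<not> split_pattern r s M} = card (frozen_part s ` fillings n j)"
proof -
  have "inj_on (frozen_part s) {M \<in> fillings n j. \<not> split_pattern r s M}"
    by (rule inj_onI) (use avoider_unique assms in blast)
  moreover have "frozen_part s ` {M \<in> fillings n j. \<not> split_pattern r s M} = frozen_part s ` fillings n j"
  proof
    show "frozen_part s ` fillings n j \<subseteq> frozen_part s ` {M \<in> fillings n j. \<not> split_pattern r s M}"
    proof (rule image_subsetI)
      fix M assume "M \<in> fillings n j"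
      then obtain M' where "M' \<in> fillings n j" "\<not> split_pattern r s M'"
        "frozen_part s M' = frozen_part s M"
        using exists_avoider[OF _ assms, of M n j s] by blast
      then show "frozen_part s M \<in> frozen_part s ` {M \<in> fillings n j. \<not> split_pattern r s M}"
        by (intro rev_image_eqI[of M']) auto
    qed
  qed auto
  ultimately show ?thesis by (metis card_image)
qed

section \<open>Antidiagonal reflection\<close>

definition antireflect :: "int \<times> int \<Rightarrow> int \<times> int" where
  "antireflect p = (- snd p, - fst p)"

lemma antireflect_invol [simp]: "antireflect (antireflect p) = p"
  by (simp add: antireflect_def)

lemma mem_antireflect_image: "(x, y) \<in> antireflect ` M \<longleftrightarrow> (- y, - x) \<in> M"
  by (force simp: antireflect_def image_iff)

lemma antireflect_fillings:
  assumes "M \<in> fillings n j"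
  shows "antireflect ` M \<in> fillings n j"
proof -
  have sub: "antireflect ` M \<subseteq> {- int n..0} \<times> {0..int n} - {(0, 0)}"
    using fillings_subset[OF assms] fillings_origin[OF assms] by (force simp: antireflect_def)
  have "{y. (- y, - x) \<in> M} = uminus ` {x'. (x', - x) \<in> M}" for x
    by (force simp: image_iff)
  then have 1: "card {y. (- y, - x) \<in> M} = card {x'. (x', - x) \<in> M}" for x
    by (simp add: card_image)
  have "{x. (- y, - x) \<in> M} = uminus ` {y'. (- y, y') \<in> M}" for y
    by (force simp: image_iff)
  then have 2: "card {x. (- y, - x) \<in> M} = card {y'. (- y, y') \<in> M}" for y
    by (simp add: card_image)
  show ?thesis using assms sub
    unfolding fillings_def mem_Collect_eq mem_antireflect_image 1 2 by auto
qed

text \<open>Reflection in the antidiagonal turns an ascent into an ascent and a descent into a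
  descent; it only changes which half lies to the lower left.\<close>

lemma split_pattern_antireflect:
  assumes r: "r = (<) \<or> r = (>)" and s: "s = (<) \<or> s = (>)" and M: "split_pattern r s M"
  shows "split_pattern s r (antireflect ` M)"
proof -
  obtain a \<alpha> b \<beta> c \<gamma> d \<delta> where p: "(a, \<alpha>) \<in> M" "(b, \<beta>) \<in> M" "(c, \<gamma>) \<in> M" "(d, \<delta>) \<in> M"
    "a < b" "b < c" "c < d" "r \<alpha> \<beta>" "s \<gamma> \<delta>" "max \<alpha> \<beta> < min \<gamma> \<delta>"
    using M unfolding split_pattern_def by blast
  \<comment> \<open>The two points of an ascent appear in the opposite order after reflection, those
    of a descent in the same order. The bounds on columns and rows serve to compare the images of
    the two halves.\<close>
  have flip: "\<exists>u \<upsilon> v \<nu>. (u, \<upsilon>) \<in> antireflect ` M \<and> (v, \<nu>) \<in> antireflect ` M \<and> u < v \<and> t \<upsilon> \<nu>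
      \<and> u \<ge> - max \<alpha> \<beta> \<and> v \<le> - min \<alpha> \<beta> \<and> min \<upsilon> \<nu> = - b \<and> max \<upsilon> \<nu> = - a"
    if "(a, \<alpha>) \<in> M" "(b, \<beta>) \<in> M" "a < b" "t \<alpha> \<beta>" "t = (<) \<or> t = (>)" for a b \<alpha> \<beta> t
    using that(5)
  proof
    assume "t = (<)"
    then show ?thesis using that
      by (intro exI[of _ "- \<beta>"] exI[of _ "- b"] exI[of _ "- \<alpha>"] exI[of _ "- a"])
        (auto simp: mem_antireflect_image)
  next
    assume "t = (>)"
    then show ?thesis using that
      by (intro exI[of _ "- \<alpha>"] exI[of _ "- a"] exI[of _ "- \<beta>"] exI[of _ "- b"])
        (auto simp: mem_antireflect_image)
  qed
  obtain u \<upsilon> v \<nu> where 1: "(u, \<upsilon>) \<in> antireflect ` M" "(v, \<nu>) \<in> antireflect ` M" "u < v" "r \<upsilon> \<nu>"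
    "u \<ge> - max \<alpha> \<beta>" "min \<upsilon> \<nu> = - b"
    using flip[OF p(1,2,5,8) r] by metis
  obtain u' \<upsilon>' v' \<nu>' where 2: "(u', \<upsilon>') \<in> antireflect ` M" "(v', \<nu>') \<in> antireflect ` M" "u' < v'"
    "s \<upsilon>' \<nu>'" "v' \<le> - min \<gamma> \<delta>" "max \<upsilon>' \<nu>' = - c"
    using flip[OF p(3,4,7,9) s] by metis
  have "v' < u" "max \<upsilon>' \<nu>' < min \<upsilon> \<nu>" using 1 2 p by linarith+
  then show ?thesis unfolding split_pattern_def using 1 2 by blast
qed

lemma card_avoiders_swap:
  assumes r: "r = (<) \<or> r = (>)" and s: "s = (<) \<or> s = (>)"
  shows "card {M \<in> fillings n j. \<not> split_pattern r s M} = card {M \<in> fillings n j. \<not> split_pattern s r M}"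
proof -
  have inv: "antireflect ` antireflect ` M = M" for M
    by (simp add: image_comp comp_def)
  have "bij_betw (image antireflect) {M \<in> fillings n j. \<not> split_pattern r s M}
      {M \<in> fillings n j. \<not> split_pattern s r M}"
  proof (rule bij_betw_byWitness[where f' = "image antireflect"])
    have "\<not> split_pattern q p (antireflect ` M)"
      if "\<not> split_pattern p q M" "p = (<) \<or> p = (>)" "q = (<) \<or> q = (>)" for p q M
      using split_pattern_antireflect[OF that(3,2), of "antireflect ` M"] that(1) inv by metis
    then show "image antireflect ` {M \<in> fillings n j. \<not> split_pattern r s M}
        \<subseteq> {M \<in> fillings n j. \<not> split_pattern s r M}"
      and "image antireflect ` {M \<in> fillings n j. \<not> split_pattern s r M}
        \<subseteq> {M \<in> fillings n j. \<not> split_pattern r s M}"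
      using r s by (auto intro!: antireflect_fillings)
  qed (simp_all add: inv)
  then show ?thesis by (rule bij_betw_same_card)
qed

text \<open>Only the lower half can be replaced directly, so the route is 1234, 2134, 1243, 2143,
  with the reflection as the middle step.\<close>

lemma card_avoiders_12_34_eq_21_43:
  "card {M \<in> fillings n j. \<not> split_pattern (<) (<) M} = card {M \<in> fillings n j. \<not> split_pattern (>) (>) M}"
proof -
  have "card {M \<in> fillings n j. \<not> split_pattern (<) (<) M} = card {M \<in> fillings n j. \<not> split_pattern (>) (<) M}"
    by (simp add: card_avoiders_frozen_parts)
  also have "\<dots> = card {M \<in> fillings n j. \<not> split_pattern (<) (>) M}"
    by (rule card_avoiders_swap) auto
  also have "\<dots> = card {M \<in> fillings n j. \<not> split_pattern (>) (>) M}"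
    by (simp add: card_avoiders_frozen_parts)
  finally show ?thesis .
qed

section \<open>Signed permutations as fillings\<close>

lemma ex_strict_mono_bij_betw:
  fixes A :: "'a::linorder set" and B :: "'b::linorder set"
  assumes "finite A" "finite B" "card A = card B"
  shows "\<exists>f. bij_betw f A B \<and> strict_mono_on A f"
  using assms
proof (induction arbitrary: B rule: finite_linorder_max_induct)
  case empty
  then show ?case by (auto simp: bij_betw_def strict_mono_on_def)
next
  case (insert b A)
  have B: "B \<noteq> {}" using insert.prems insert.hyps(1) by auto
  have b: "b \<notin> A" using insert.hyps by auto
  then have "card A = card B - 1"
    using insert.prems insert.hyps(1) by simp
  then have "card A = card (B - {Max B})"
    using B insert.prems by (simp add: card_Diff_singleton)
  then obtain f where f: "bij_betw f A (B - {Max B})" "strict_mono_on A f"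
    using insert.IH[of "B - {Max B}"] insert.prems by auto
  have "bij_betw (f(b := Max B)) A (B - {Max B})"
    using f(1) b by (metis bij_betw_cong fun_upd_other)
  then have "bij_betw (f(b := Max B)) (insert b A) (insert (Max B) (B - {Max B}))"
    using notIn_Un_bij_betw[of b A "f(b := Max B)" "B - {Max B}"] b by simp
  moreover have "insert (Max B) (B - {Max B}) = B"
    using B insert.prems by (simp add: insert_absorb)
  moreover have "f x < Max B" if "x \<in> A" for x
    using that f(1) insert.prems bij_betwE[OF f(1)] by (metis DiffE Max_ge insertI1 order_le_less)
  then have "strict_mono_on (insert b A) (f(b := Max B))"
    using f(2) insert.hyps b by (fastforce simp: strict_mono_on_def)
  ultimately show ?case by metis
qed

section \<open>Patterns of length 4 in the graph of a signed permutation\<close>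

lemma contains_pattern_length_4:
  "contains_pattern S w [p0, p1, p2, p3] \<longleftrightarrow> (\<exists>a b c d. a \<in> S \<and> b \<in> S \<and> c \<in> S \<and> d \<in> S
      \<and> a < b \<and> b < c \<and> c < d
      \<and> (\<forall>(x, p)\<in>{(a, p0), (b, p1), (c, p2), (d, p3)}.
          \<forall>(y, q)\<in>{(a, p0), (b, p1), (c, p2), (d, p3)}. w x < w y \<longleftrightarrow> p < q))"
    (is "_ \<longleftrightarrow> ?R")
proof -
  have all4: "(\<forall>i < length [p0, p1, p2, p3]. P i) \<longleftrightarrow> P 0 \<and> P 1 \<and> P 2 \<and> P 3" for P :: "nat \<Rightarrow> bool"
    by (auto simp: less_Suc_eq eval_nat_numeral)
  have nth: "[q0, q1, q2, q3] ! 0 = q0" "[q0, q1, q2, q3] ! 1 = q1" "[q0, q1, q2, q3] ! 2 = q2"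
    "[q0, q1, q2, q3] ! 3 = q3" for q0 q1 q2 q3 :: 'b
    by (simp_all add: eval_nat_numeral)
  show ?thesis
  proof
    assume "contains_pattern S w [p0, p1, p2, p3]"
    then obtain idx :: "nat \<Rightarrow> int" where idx: "\<forall>i < length [p0, p1, p2, p3]. idx i \<in> S"
      "\<And>i j. i < j \<Longrightarrow> j < length [p0, p1, p2, p3] \<Longrightarrow> idx i < idx j"
      "\<forall>i < length [p0, p1, p2, p3]. \<forall>j < length [p0, p1, p2, p3].
        w (idx i) < w (idx j) \<longleftrightarrow> [p0, p1, p2, p3] ! i < [p0, p1, p2, p3] ! j"
      unfolding contains_pattern_def by blast
    have "idx 0 < idx 1" "idx 1 < idx 2" "idx 2 < idx 3" using idx(2) by simp_all
    then show ?R
      using idx(1,3) unfolding all4 nth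
      by (intro exI[of _ "idx 0"] exI[of _ "idx 1"] exI[of _ "idx 2"] exI[of _ "idx 3"]) simp
  next
    assume ?R
    then obtain a b c d where *: "a \<in> S" "b \<in> S" "c \<in> S" "d \<in> S" "a < b" "b < c" "c < d"
      "\<forall>(x, p)\<in>{(a, p0), (b, p1), (c, p2), (d, p3)}.
        \<forall>(y, q)\<in>{(a, p0), (b, p1), (c, p2), (d, p3)}. w x < w y \<longleftrightarrow> p < q" by blast
    have mono: "[a, b, c, d] ! i < [a, b, c, d] ! j" if "i < j" "j < length [p0, p1, p2, p3]" for i j
      using that *(5-7) by (auto simp: less_Suc_eq eval_nat_numeral)
    show "contains_pattern S w [p0, p1, p2, p3]"
      unfolding contains_pattern_def
    proof (intro exI[of _ "(!) [a, b, c, d]"] conjI)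
      show "\<forall>i j. i < j \<and> j < length [p0, p1, p2, p3] \<longrightarrow> [a, b, c, d] ! i < [a, b, c, d] ! j"
        using mono by blast
    qed (use * in \<open>simp_all only: all4 nth, simp_all\<close>)
  qed
qed

abbreviation signed_graph :: "nat \<Rightarrow> (int \<Rightarrow> int) \<Rightarrow> (int \<times> int) set" where
  "signed_graph n w \<equiv> (\<lambda>i. (i, w i)) ` signed_dom n"

lemma split_pattern_signed_graphI:
  assumes "a \<in> signed_dom n" "b \<in> signed_dom n" "c \<in> signed_dom n" "d \<in> signed_dom n"
    and "a < b" "b < c" "c < d" "r (w a) (w b)" "s (w c) (w d)"
    and "max (w a) (w b) < min (w c) (w d)"
  shows "split_pattern r s (signed_graph n w)"
  unfolding split_pattern_def
proof (intro exI conjI)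
  show "(a, w a) \<in> signed_graph n w" "(b, w b) \<in> signed_graph n w"
    "(c, w c) \<in> signed_graph n w" "(d, w d) \<in> signed_graph n w"
    using assms by auto
qed (fact assms)+

lemma split_pattern_signed_graphE:
  assumes "split_pattern r s (signed_graph n w)"
  obtains a b c d where "a \<in> signed_dom n" "b \<in> signed_dom n" "c \<in> signed_dom n" "d \<in> signed_dom n"
    "a < b" "b < c" "c < d" "r (w a) (w b)" "s (w c) (w d)" "max (w a) (w b) < min (w c) (w d)"
proof -
  obtain a \<alpha> b \<beta> c \<gamma> d \<delta> where pts: "(a, \<alpha>) \<in> signed_graph n w" "(b, \<beta>) \<in> signed_graph n w"
      "(c, \<gamma>) \<in> signed_graph n w" "(d, \<delta>) \<in> signed_graph n w"
    and ord: "a < b" "b < c" "c < d" "r \<alpha> \<beta>" "s \<gamma> \<delta>" "max \<alpha> \<beta> < min \<gamma> \<delta>"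
    using assms unfolding split_pattern_def by blast
  have "i \<in> signed_dom n \<and> v = w i" if "(i, v) \<in> signed_graph n w" for i v
    using that by auto
  with pts ord show ?thesis using that by blast
qed

lemma contains_pattern_1234:
  "contains_pattern (signed_dom n) w [1, 2, 3, 4] \<longleftrightarrow> split_pattern (<) (<) (signed_graph n w)"
proof
  assume "contains_pattern (signed_dom n) w [1, 2, 3, 4]"
  then obtain a b c d where dom: "a \<in> signed_dom n" "b \<in> signed_dom n" "c \<in> signed_dom n"
      "d \<in> signed_dom n" "a < b" "b < c" "c < d"
    and ord: "\<forall>(x, p)\<in>{(a, 1), (b, 2), (c, 3), (d, 4)}.
      \<forall>(y, q)\<in>{(a, 1), (b, 2), (c, 3), (d, 4)}. w x < w y \<longleftrightarrow> p < (q :: nat)"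
    unfolding contains_pattern_length_4 by blast
  show "split_pattern (<) (<) (signed_graph n w)"
    by (rule split_pattern_signed_graphI[OF dom]) (use ord in simp_all)
next
  assume "split_pattern (<) (<) (signed_graph n w)"
  then obtain a b c d where "a \<in> signed_dom n" "b \<in> signed_dom n" "c \<in> signed_dom n" "d \<in> signed_dom n"
    "a < b" "b < c" "c < d" "w a < w b" "w c < w d" "max (w a) (w b) < min (w c) (w d)"
    by (rule split_pattern_signed_graphE)
  then show "contains_pattern (signed_dom n) w [1, 2, 3, 4]"
    unfolding contains_pattern_length_4
    by (intro exI[of _ a] exI[of _ b] exI[of _ c] exI[of _ d]) simp
qed

lemma contains_pattern_2143:
  "contains_pattern (signed_dom n) w [2, 1, 4, 3] \<longleftrightarrow> split_pattern (>) (>) (signed_graph n w)"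
proof
  assume "contains_pattern (signed_dom n) w [2, 1, 4, 3]"
  then obtain a b c d where dom: "a \<in> signed_dom n" "b \<in> signed_dom n" "c \<in> signed_dom n"
      "d \<in> signed_dom n" "a < b" "b < c" "c < d"
    and ord: "\<forall>(x, p)\<in>{(a, 2), (b, 1), (c, 4), (d, 3)}.
      \<forall>(y, q)\<in>{(a, 2), (b, 1), (c, 4), (d, 3)}. w x < w y \<longleftrightarrow> p < (q :: nat)"
    unfolding contains_pattern_length_4 by blast
  show "split_pattern (>) (>) (signed_graph n w)"
    by (rule split_pattern_signed_graphI[OF dom]) (use ord in simp_all)
next
  assume "split_pattern (>) (>) (signed_graph n w)"
  then obtain a b c d where "a \<in> signed_dom n" "b \<in> signed_dom n" "c \<in> signed_dom n" "d \<in> signed_dom n"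
    "a < b" "b < c" "c < d" "w a > w b" "w c > w d" "max (w a) (w b) < min (w c) (w d)"
    by (rule split_pattern_signed_graphE)
  then show "contains_pattern (signed_dom n) w [2, 1, 4, 3]"
    unfolding contains_pattern_length_4
    by (intro exI[of _ a] exI[of _ b] exI[of _ c] exI[of _ d]) simp
qed

lemma signed_dom_iff: "i \<in> signed_dom n \<longleftrightarrow> - int n \<le> i \<and> i \<le> int n \<and> i \<noteq> 0"
  by (auto simp: signed_dom_def)

lemma uminus_signed_dom [simp]: "- i \<in> signed_dom n \<longleftrightarrow> i \<in> signed_dom n"
  by (auto simp: signed_dom_iff)

lemma signed_perms_mem: "w \<in> signed_perms n \<Longrightarrow> i \<in> signed_dom n \<Longrightarrow> w i \<in> signed_dom n"
  by (auto simp: signed_perms_def dest: bij_betwE)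

lemma signed_perms_uminus: "w \<in> signed_perms n \<Longrightarrow> i \<in> signed_dom n \<Longrightarrow> w (- i) = - w i"
  by (simp add: signed_perms_def)

lemma signed_perms_inj:
  "w \<in> signed_perms n \<Longrightarrow> i \<in> signed_dom n \<Longrightarrow> k \<in> signed_dom n \<Longrightarrow> w i = w k \<Longrightarrow> i = k"
  unfolding signed_perms_def bij_betw_def inj_on_def by blast

lemma signed_perms_surj:
  assumes "w \<in> signed_perms n" "v \<in> signed_dom n"
  obtains i where "i \<in> signed_dom n" "w i = v"
proof -
  have "w ` signed_dom n = signed_dom n" using assms(1) by (simp add: signed_perms_def bij_betw_def)
  then have "v \<in> w ` signed_dom n" using assms(2) by simp
  then show ?thesis by (elim imageE) (use that in simp)
qed

section \<open>Squeezing the graph into the upper left quadrant\<close>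

definition quadrant_avoids :: "(int \<Rightarrow> int \<Rightarrow> bool) \<Rightarrow> nat \<Rightarrow> (int \<Rightarrow> int) \<Rightarrow> bool" where
  "quadrant_avoids r n w \<longleftrightarrow> (\<forall>a\<in>signed_dom n. \<forall>b\<in>signed_dom n.
      a < b \<and> b < 0 \<and> w a < 0 \<and> w b < 0 \<longrightarrow> \<not> r (w a) (w b))"

lemma quadrant_avoids_if_avoids:
  assumes w: "w \<in> signed_perms n" and r: "r = (<) \<or> r = (>)"
    and avoid: "\<not> split_pattern r r (signed_graph n w)"
  shows "quadrant_avoids r n w"
  unfolding quadrant_avoids_def
proof (intro ballI impI notI)
  fix a b assume ab: "a \<in> signed_dom n" "b \<in> signed_dom n"
    and *: "a < b \<and> b < 0 \<and> w a < 0 \<and> w b < 0" "r (w a) (w b)"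
  have neg: "w (- a) = - w a" "w (- b) = - w b" using signed_perms_uminus w ab by auto
  have "split_pattern r r (signed_graph n w)"
  proof (rule split_pattern_signed_graphI[of a n b "- b" "- a"])
    show "r (w (- b)) (w (- a))" using r * neg by auto
  qed (use ab * neg in auto)
  with avoid show False ..
qed

definition fold_quadrants :: "nat \<Rightarrow> (int \<Rightarrow> int) \<Rightarrow> (int \<times> int) set" where
  "fold_quadrants n w = {(min i 0, max (w i) 0) | i. i \<in> signed_dom n \<and> (i < 0 \<or> w i > 0)}"

lemma fold_quadrantsI:
  "i \<in> signed_dom n \<Longrightarrow> i < 0 \<or> w i > 0 \<Longrightarrow> (min i 0, max (w i) 0) \<in> fold_quadrants n w"
  unfolding fold_quadrants_def by blast

lemma fold_quadrantsE:
  assumes "(x, y) \<in> fold_quadrants n w"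
  obtains i where "i \<in> signed_dom n" "i < 0 \<or> w i > 0" "x = min i 0" "y = max (w i) 0"
  using assms unfolding fold_quadrants_def by blast

text \<open>Truncation at 0 is weakly monotone, so every strict inequality between squeezed
  coordinates already holds between the original ones.\<close>

lemma split_pattern_if_fold:
  assumes r: "r = (<) \<or> r = (>)" and "split_pattern r r (fold_quadrants n w)"
  shows "split_pattern r r (signed_graph n w)"
proof -
  obtain a b c d where dom: "a \<in> signed_dom n" "b \<in> signed_dom n" "c \<in> signed_dom n" "d \<in> signed_dom n"
    and lt: "min a 0 < min b 0" "min b 0 < min c 0" "min c 0 < min d 0"
    and rs: "r (max (w a) 0) (max (w b) 0)" "r (max (w c) 0) (max (w d) 0)"
    and mm: "max (max (w a) 0) (max (w b) 0) < min (max (w c) 0) (max (w d) 0)"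
    using assms(2) unfolding split_pattern_def by (metis fold_quadrantsE)
  show ?thesis
  proof (rule split_pattern_signed_graphI[OF dom])
    show "r (w a) (w b)" "r (w c) (w d)" using r rs by auto
    show "a < b" "b < c" "c < d" using lt by linarith+
    show "max (w a) (w b) < min (w c) (w d)" using mm by linarith
  qed
qed

text \<open>Squeezing destroys an occurrence if both points of its lower half fall into row 0, or
  both points of its upper half into column 0. \<open>quadrant_avoids\<close> excludes these cases,
  the second one by symmetry.\<close>

lemma split_pattern_fold:
  assumes w: "w \<in> signed_perms n" and r: "r = (<) \<or> r = (>)" and q: "quadrant_avoids r n w"
    and sp: "split_pattern r r (signed_graph n w)"
  shows "split_pattern r r (fold_quadrants n w)"
proof -
  \<comment> \<open>If \<open>b < 0\<close>, no point of the occurrence lies in the lower right quadrant; otherwise \<open>- c < 0\<close>,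
    and the mirror image of the occurrence has this property.\<close>
  have *: "split_pattern r r (fold_quadrants n w)"
    if dom: "a \<in> signed_dom n" "b \<in> signed_dom n" "c \<in> signed_dom n" "d \<in> signed_dom n"
      and lt: "a < b" "b < c" "c < d" and rs: "r (w a) (w b)" "r (w c) (w d)"
      and mm: "max (w a) (w b) < min (w c) (w d)" and b: "b < 0" for a b c d
  proof -
    have nz: "w a \<noteq> 0" "w b \<noteq> 0" "c \<noteq> 0" "d \<noteq> 0"
      using signed_perms_mem[OF w] dom by (auto simp: signed_dom_iff)
    have "\<not> (w a < 0 \<and> w b < 0)"
      using q dom lt rs b unfolding quadrant_avoids_def by blast
    then have pos: "max (w a) (w b) > 0" using nz by linarith
    then have pos': "w c > 0" "w d > 0" using mm by linarith+
    \<comment> \<open>Otherwise \<open>c\<close> and \<open>d\<close> give a pair in the upper right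
      quadrant, whose mirror image at \<open>- d\<close> and \<open>- c\<close> is a forbidden pair
      in the lower left one.\<close>
    have "\<not> (c > 0 \<and> d > 0)"
    proof
      assume cd: "c > 0 \<and> d > 0"
      have neg: "w (- c) = - w c" "w (- d) = - w d" using signed_perms_uminus[OF w] dom by auto
      moreover have "r (- w d) (- w c)" using r rs by auto
      moreover have "- c \<in> signed_dom n" "- d \<in> signed_dom n" "- d < - c" "- c < 0" using dom lt cd by auto
      ultimately show False using q pos' unfolding quadrant_avoids_def by (metis neg_less_0_iff_less)
    qed
    then have "c < 0" using nz lt by linarith
    show ?thesis
      unfolding split_pattern_def
    proof (intro exI conjI)
      show "(min a 0, max (w a) 0) \<in> fold_quadrants n w"
        by (rule fold_quadrantsI) (use dom lt b in auto)
      show "(min b 0, max (w b) 0) \<in> fold_quadrants n w"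
        by (rule fold_quadrantsI) (use dom lt b in auto)
      show "(min c 0, max (w c) 0) \<in> fold_quadrants n w"
        by (rule fold_quadrantsI) (use dom pos' in auto)
      show "(min d 0, max (w d) 0) \<in> fold_quadrants n w"
        by (rule fold_quadrantsI) (use dom pos' in auto)
      show "min a 0 < min b 0" "min b 0 < min c 0" "min c 0 < min d 0"
        using lt b \<open>c < 0\<close> by linarith+
      show "max (max (w a) 0) (max (w b) 0) < min (max (w c) 0) (max (w d) 0)"
        using mm pos by linarith
      show "r (max (w a) 0) (max (w b) 0)" using r rs(1) pos by auto
      show "r (max (w c) 0) (max (w d) 0)" using r rs(2) pos' by auto
    qed
  qed
  obtain a b c d where dom: "a \<in> signed_dom n" "b \<in> signed_dom n" "c \<in> signed_dom n" "d \<in> signed_dom n"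
    and lt: "a < b" "b < c" "c < d" and rs: "r (w a) (w b)" "r (w c) (w d)"
    and mm: "max (w a) (w b) < min (w c) (w d)"
    using sp by (rule split_pattern_signed_graphE)
  show ?thesis
  proof (cases "b < 0")
    case True
    then show ?thesis using * dom lt rs mm by blast
  next
    case False
    have neg: "w (- a) = - w a" "w (- b) = - w b" "w (- c) = - w c" "w (- d) = - w d"
      using signed_perms_uminus[OF w] dom by auto
    show ?thesis
    proof (rule *[of "- d" "- c" "- b" "- a"])
      show "r (w (- d)) (w (- c))" "r (w (- b)) (w (- a))" using r rs neg by auto
    qed (use dom lt mm neg False in auto)
  qed
qed

lemma fold_quadrants_column:
  assumes "x \<in> signed_dom n" "x < 0"
  shows "(x, y) \<in> fold_quadrants n w \<longleftrightarrow> y = max (w x) 0"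
proof
  assume "(x, y) \<in> fold_quadrants n w"
  then obtain i where "x = min i 0" "y = max (w i) 0" by (rule fold_quadrantsE)
  moreover from this have "i = x" using assms(2) by (simp split: if_splits add: min_def)
  ultimately show "y = max (w x) 0" by simp
next
  assume "y = max (w x) 0"
  then show "(x, y) \<in> fold_quadrants n w"
    using fold_quadrantsI[of x n w] assms by (simp add: min_def)
qed

lemma fold_quadrants_column_0:
  "(0, y) \<in> fold_quadrants n w \<longleftrightarrow> (\<exists>i\<in>{1..int n}. w i > 0 \<and> y = w i)"
proof
  assume "(0, y) \<in> fold_quadrants n w"
  then obtain i where i: "i \<in> signed_dom n" "i < 0 \<or> w i > 0" "0 = min i 0" "y = max (w i) 0"
    by (rule fold_quadrantsE)
  then have "i > 0" by (auto simp: signed_dom_iff min_def split: if_splits)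
  then show "\<exists>i\<in>{1..int n}. w i > 0 \<and> y = w i"
    using i by (intro bexI[of _ i]) (auto simp: signed_dom_iff)
next
  assume "\<exists>i\<in>{1..int n}. w i > 0 \<and> y = w i"
  then obtain i where "i \<in> {1..int n}" "w i > 0" "y = w i" by blast
  then show "(0, y) \<in> fold_quadrants n w"
    using fold_quadrantsI[of i n w] by (simp add: signed_dom_iff)
qed

lemma card_fold_quadrants_column_0:
  assumes "w \<in> signed_perms n"
  shows "card {y. (0, y) \<in> fold_quadrants n w} = card {i \<in> {1..int n}. w i > 0}"
proof -
  have "{y. (0, y) \<in> fold_quadrants n w} = w ` {i \<in> {1..int n}. w i > 0}"
    unfolding fold_quadrants_column_0 by auto
  moreover have "inj_on w {i \<in> {1..int n}. w i > 0}"
    using signed_perms_inj[OF assms] by (auto simp: inj_on_def signed_dom_iff)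
  ultimately show ?thesis by (simp add: card_image)
qed

lemma fold_quadrants_fillings:
  assumes w: "w \<in> signed_perms n" and j: "card {i \<in> {1..int n}. w i > 0} = j"
  shows "fold_quadrants n w \<in> fillings n j"
proof -
  have sub: "fold_quadrants n w \<subseteq> {- int n..0} \<times> {0..int n} - {(0, 0)}"
  proof clarify
    fix x y assume "(x, y) \<in> fold_quadrants n w"
    then obtain i where i: "i \<in> signed_dom n" "i < 0 \<or> w i > 0" "x = min i 0" "y = max (w i) 0"
      by (rule fold_quadrantsE)
    then show "(x, y) \<in> {- int n..0} \<times> {0..int n} - {(0, 0)}"
      using signed_perms_mem[OF w i(1)] by (auto simp: signed_dom_iff)
  qed
  have col: "card {y. (x, y) \<in> fold_quadrants n w} = (if x = 0 then j else 1)" if "x \<in> {- int n..0}" for x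
  proof (cases "x = 0")
    case True
    then show ?thesis using card_fold_quadrants_column_0[OF w] j by simp
  next
    case False
    then have "{y. (x, y) \<in> fold_quadrants n w} = {max (w x) 0}"
      using that fold_quadrants_column[of x n] by (auto simp: signed_dom_iff)
    then show ?thesis using False by simp
  qed
  \<comment> \<open>Row 0 comes from the lower left quadrant, the mirror image of the upper right
    one, so it has as many points as column 0.\<close>
  have row0: "{x. (x, 0) \<in> fold_quadrants n w} = uminus ` {i \<in> {1..int n}. w i > 0}"
  proof (intro set_eqI iffI)
    fix x assume "x \<in> {x. (x, 0) \<in> fold_quadrants n w}"
    then have "(x, 0) \<in> fold_quadrants n w" by simp
    then obtain i where i: "i \<in> signed_dom n" "i < 0 \<or> w i > 0" "x = min i 0" "0 = max (w i) 0"
      by (rule fold_quadrantsE)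
    then have "i < 0" "w i < 0" using signed_perms_mem[OF w i(1)] by (auto simp: signed_dom_iff)
    then have "x = - (- i)" "- i \<in> {i \<in> {1..int n}. w i > 0}"
      using i signed_perms_uminus[OF w i(1)] by (auto simp: signed_dom_iff)
    then show "x \<in> uminus ` {i \<in> {1..int n}. w i > 0}" by blast
  next
    fix x assume "x \<in> uminus ` {i \<in> {1..int n}. w i > 0}"
    then obtain i where i: "i \<in> {1..int n}" "w i > 0" "x = - i" by blast
    then have "i \<in> signed_dom n" by (simp add: signed_dom_iff)
    then show "x \<in> {x. (x, 0) \<in> fold_quadrants n w}"
      using i signed_perms_uminus[OF w, of i] fold_quadrants_column[of x n 0 w] by simp
  qed
  have row: "card {x. (x, y) \<in> fold_quadrants n w} = (if y = 0 then j else 1)" if y: "y \<in> {0..int n}" for y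
  proof (cases "y = 0")
    case True
    then show ?thesis using j by (simp add: row0 card_image)
  next
    case False
    then have "y \<in> signed_dom n" "y > 0" using y by (auto simp: signed_dom_iff)
    then obtain i where i: "i \<in> signed_dom n" "w i = y" using signed_perms_surj[OF w] by metis
    have "{x. (x, y) \<in> fold_quadrants n w} = {min i 0}"
    proof (intro set_eqI iffI)
      fix x assume "x \<in> {x. (x, y) \<in> fold_quadrants n w}"
      then have "(x, y) \<in> fold_quadrants n w" by simp
      then obtain k where k: "k \<in> signed_dom n" "x = min k 0" "y = max (w k) 0"
        by (rule fold_quadrantsE)
      then have "w k = w i" using i \<open>y > 0\<close> by (simp add: max_def split: if_splits)
      then show "x \<in> {min i 0}" using signed_perms_inj[OF w k(1) i(1)] k by simp
    next
      fix x assume "x \<in> {min i 0}"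
      then show "x \<in> {x. (x, y) \<in> fold_quadrants n w}"
        using fold_quadrantsI[of i n w] i \<open>y > 0\<close> by simp
    qed
    then show ?thesis using False by simp
  qed
  show ?thesis unfolding fillings_def using sub col row by blast
qed

text \<open>The squeezed diagram forgets only how the positions and the values of the lower left
  quadrant are matched, and \<open>quadrant_avoids\<close> forces this matching to be monotone. At
  the last negative position \<open>x\<close> of disagreement, each of the values \<open>w x\<close>
  and \<open>w' x\<close> occurs further left in the other permutation, so neither order of the two
  values is allowed.\<close>

lemma fold_quadrants_inj:
  assumes w: "w \<in> signed_perms n" "quadrant_avoids r n w"
    and w': "w' \<in> signed_perms n" "quadrant_avoids r n w'"
    and r: "r = (<) \<or> r = (>)" and eq: "fold_quadrants n w = fold_quadrants n w'"
  shows "w = w'"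
proof (rule ccontr)
  assume "w \<noteq> w'"
  then obtain i0 where i0: "w i0 \<noteq> w' i0" by blast
  have "i0 \<in> signed_dom n"
    using w(1) w'(1) i0 unfolding signed_perms_def by force
  define X where "X = {i \<in> signed_dom n. i < 0 \<and> w i \<noteq> w' i}"
  have "i0 \<in> X \<or> - i0 \<in> X"
    using i0 \<open>i0 \<in> signed_dom n\<close> signed_perms_uminus[OF w(1), of i0] signed_perms_uminus[OF w'(1), of i0]
    by (auto simp: X_def signed_dom_iff)
  then have "X \<noteq> {}" by blast
  moreover have "finite X"
    by (rule finite_subset[of _ "{- int n..int n}"]) (auto simp: X_def signed_dom_iff)
  ultimately have "Max X \<in> X" and max: "\<And>i. i \<in> X \<Longrightarrow> i \<le> Max X" by auto
  define x where "x = Max X"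
  have x: "x \<in> signed_dom n" "x < 0" "w x \<noteq> w' x" using \<open>Max X \<in> X\<close> by (auto simp: X_def x_def)
  have agree: "w i = w' i" if "i \<in> signed_dom n" "i < 0" "x < i" for i
    using max[of i] that by (force simp: X_def x_def)
  \<comment> \<open>The mirror image of the point at \<open>x\<close> puts \<open>- u x\<close> into
    column 0 of the common diagram, so \<open>u'\<close> also takes the value \<open>u x\<close> at
    a negative position. That position is not to the right of \<open>x\<close>, where
    \<open>u\<close> and \<open>u'\<close> agree and \<open>u\<close> is injective.\<close>
  have partner: "\<exists>i\<in>signed_dom n. i < x \<and> u' i = u x"
    if u: "u \<in> signed_perms n" and u': "u' \<in> signed_perms n"
      and neg: "u x < 0" and ne: "u x \<noteq> u' x" and eq: "fold_quadrants n u = fold_quadrants n u'"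
      and agr: "\<And>i. i \<in> signed_dom n \<Longrightarrow> i < 0 \<Longrightarrow> x < i \<Longrightarrow> u i = u' i" for u u'
  proof -
    have "(0, - u x) \<in> fold_quadrants n u"
      unfolding fold_quadrants_column_0
      using x(1,2) neg signed_perms_uminus[OF u x(1)] by (intro bexI[of _ "- x"]) (auto simp: signed_dom_iff)
    then obtain k where k: "k \<in> {1..int n}" "- u x = u' k"
      unfolding eq fold_quadrants_column_0 by blast
    then have kd: "k \<in> signed_dom n" by (simp add: signed_dom_iff)
    have uk: "u' (- k) = u x" using signed_perms_uminus[OF u' kd] k by simp
    have "- k \<noteq> x" using uk ne by metis
    moreover have "\<not> x < - k"
    proof
      assume "x < - k"
      then have "u (- k) = u x" using agr[of "- k"] kd k uk by simp
      then show False using signed_perms_inj[OF u _ x(1), of "- k"] kd \<open>- k \<noteq> x\<close> by simp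
    qed
    ultimately show ?thesis using kd uk by (intro bexI[of _ "- k"]) auto
  qed
  have "max (w x) 0 = max (w' x) 0"
    using fold_quadrants_column[OF x(1,2)] eq by metis
  then have neg: "w x < 0" "w' x < 0"
    using x(3) signed_perms_mem[OF w(1) x(1)] signed_perms_mem[OF w'(1) x(1)]
    by (auto simp: signed_dom_iff max_def split: if_splits)
  obtain i where i: "i \<in> signed_dom n" "i < x" "w' i = w x"
    using partner[OF w(1) w'(1) neg(1) x(3) eq agree] by blast
  obtain i' where i': "i' \<in> signed_dom n" "i' < x" "w i' = w' x"
    using partner[OF w'(1) w(1) neg(2) x(3)[symmetric] eq[symmetric] agree[symmetric]] by blast
  have "\<not> r (w x) (w' x)"
    using w'(2) i x(1,2) neg unfolding quadrant_avoids_def by metis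
  moreover have "\<not> r (w' x) (w x)"
    using w(2) i' x(1,2) neg unfolding quadrant_avoids_def by metis
  ultimately show False using r x(3) by auto
qed

section \<open>Recovering a signed permutation from its squeezed diagram\<close>

lemma ex_monotone_bij_betw:
  fixes A B :: "int set"
  assumes "finite A" "finite B" "card A = card B" and r: "r = (<) \<or> r = (>)"
  shows "\<exists>f. bij_betw f A B \<and> (\<forall>a\<in>A. \<forall>b\<in>A. a < b \<longrightarrow> \<not> r (f a) (f b))"
  using r
proof
  assume r: "r = (>)"
  obtain f where "bij_betw f A B" "strict_mono_on A f"
    using ex_strict_mono_bij_betw assms by metis
  then show ?thesis using r by (intro exI[of _ f]) (fastforce simp: strict_mono_on_def)
next
  assume r: "r = (<)"
  have "card A = card (uminus ` B)" using assms by (simp add: card_image)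
  then obtain f where f: "bij_betw f A (uminus ` B)" "strict_mono_on A f"
    using ex_strict_mono_bij_betw[of A "uminus ` B"] assms by auto
  have "bij_betw uminus (uminus ` B) B"
    by (rule bij_betw_byWitness[where f' = uminus]) auto
  then have "bij_betw (uminus \<circ> f) A B" using f(1) by (rule bij_betw_trans[rotated])
  then show ?thesis using f(2) r
    by (intro exI[of _ "uminus \<circ> f"]) (fastforce simp: strict_mono_on_def)
qed

text \<open>Row 0 shows the positions \<open>C\<close> and column 0 the values \<open>R\<close> of
  the lower left quadrant. These sets have the same size \<open>j\<close>, so they can be matched
  monotonically; the remaining negative positions take their values from \<open>M\<close>, and the
  positive ones follow by symmetry.\<close>

lemma fold_quadrants_surj:
  assumes M: "M \<in> fillings n j" and r: "r = (<) \<or> r = (>)"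
  shows "\<exists>w\<in>signed_perms n. quadrant_avoids r n w \<and> fold_quadrants n w = M"
proof -
  define N where "N = {- int n..-1}"
  define C where "C = {x. (x, 0) \<in> M}"
  \<comment> \<open>A value \<open>- v\<close> of the upper right quadrant appears as
    \<open>v\<close> in the lower left one.\<close>
  define R where "R = {v. (0, - v) \<in> M}"
  have dom_split: "i \<in> signed_dom n \<longleftrightarrow> i \<in> N \<or> - i \<in> N" for i
    by (auto simp: signed_dom_iff N_def)
  have C: "C \<subseteq> N"
  proof
    fix x assume "x \<in> C"
    then have "(x, 0) \<in> M" by (simp add: C_def)
    then show "x \<in> N" using fillings_bounds[OF M, of x 0] fillings_origin[OF M]
      by (cases "x = 0") (auto simp: N_def)
  qed
  have R: "R \<subseteq> N"
  proof
    fix v assume "v \<in> R"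
    then have "(0, - v) \<in> M" by (simp add: R_def)
    then show "v \<in> N" using fillings_bounds[OF M, of 0 "- v"] fillings_origin[OF M]
      by (cases "v = 0") (auto simp: N_def)
  qed
  have fin: "finite C" "finite R" using C R finite_subset[of _ N] by (auto simp: N_def)
  have "R = uminus ` {y. (0, y) \<in> M}" by (force simp: R_def image_iff)
  then have "card R = card {y. (0, y) \<in> M}" by (simp add: card_image)
  then have "card C = card R" using M by (simp add: C_def fillings_def)
  then obtain f where f: "bij_betw f C R" "\<forall>a\<in>C. \<forall>b\<in>C. a < b \<longrightarrow> \<not> r (f a) (f b)"
    using ex_monotone_bij_betw[OF fin _ r] by blast
  define u where "u x = (if x \<in> C then f x else THE y. (x, y) \<in> M)" for x
  have uC: "u x \<in> R" "u x < 0" "(0, - u x) \<in> M" if "x \<in> C" for x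
  proof -
    show "u x \<in> R" using that f(1) by (auto simp: u_def dest: bij_betwE)
    then show "u x < 0" "(0, - u x) \<in> M" using R by (auto simp: N_def R_def)
  qed
  have uN: "(x, u x) \<in> M" "u x > 0" if "x \<in> N" "x \<notin> C" for x
  proof -
    have "\<exists>!y. (x, y) \<in> M" using fillings_column[OF M, of x] that by (auto simp: N_def)
    then show *: "(x, u x) \<in> M" using that theI'[of "\<lambda>y. (x, y) \<in> M"] by (simp add: u_def)
    then have "u x \<noteq> 0" using that by (auto simp: C_def)
    then show "u x > 0" using fillings_bounds[OF M *] by simp
  qed
  have u_sign: "u x < 0 \<longleftrightarrow> x \<in> C" if "x \<in> N" for x using uC(2) uN(2) that by force
  have u_col: "max (u x) 0 = y \<longleftrightarrow> (x, y) \<in> M" if "x \<in> N" for x y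
  proof -
    have "(x, max (u x) 0) \<in> M"
    proof (cases "x \<in> C")
      case True
      then show ?thesis using uC(2)[OF True] by (simp add: C_def)
    next
      case False
      then show ?thesis using uN[OF that False] by simp
    qed
    moreover have "\<exists>!y. (x, y) \<in> M" using fillings_column[OF M, of x] that by (auto simp: N_def)
    ultimately show ?thesis by blast
  qed
  have u_dom: "u x \<in> signed_dom n" if "x \<in> N" for x
    using uC[of x] uN[of x] R fillings_bounds[OF M, of x "u x"] that
    by (cases "x \<in> C") (auto simp: signed_dom_iff N_def)
  \<comment> \<open>Injectivity of the absolute values, not merely of \<open>u\<close>, is what
    makes the odd extension of \<open>u\<close> injective.\<close>
  have u_inj: "x = y" if "x \<in> N" "y \<in> N" and abs: "\<bar>u x\<bar> = \<bar>u y\<bar>" for x y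
  proof -
    \<comment> \<open>The column of \<open>M\<close> in which row \<open>\<bar>u z\<bar>\<close> has
      its only point: column 0 if the point at \<open>z\<close> is squeezed, and \<open>z\<close>
      otherwise.\<close>
    define cell where "cell z = (if z \<in> C then 0 else z)" for z
    have cell: "(cell z, \<bar>u z\<bar>) \<in> M" if "z \<in> N" for z
      using uC[of z] uN[of z] that by (auto simp: cell_def)
    have "\<bar>u x\<bar> \<in> {0..int n}" "\<bar>u x\<bar> \<noteq> 0" using u_dom[OF that(1)] by (auto simp: signed_dom_iff)
    then have "cell x = cell y"
      using fillings_row[OF M] cell[OF that(1)] cell[OF that(2)] abs by metis
    moreover have "x \<noteq> 0" "y \<noteq> 0" using that(1,2) by (auto simp: N_def)
    ultimately consider "x = y" | "x \<in> C" "y \<in> C"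
      by (auto simp: cell_def split: if_splits)
    then show ?thesis
    proof cases
      case 2
      then have "f x = f y" using abs uC(2)[of x] uC(2)[of y] by (simp add: u_def)
      then show ?thesis using 2 f(1) by (auto simp: bij_betw_def dest: inj_onD)
    qed
  qed
  \<comment> \<open>The odd extension of \<open>u\<close>, with the identity outside
    \<open>signed_dom n\<close> as \<open>signed_perms\<close> demands.\<close>
  define w where "w i = (if i \<in> N then u i else if - i \<in> N then - u (- i) else i)" for i
  have w_neg: "w i = u i" if "i \<in> N" for i using that by (simp add: w_def)
  have w_pos: "w (- i) = - u i" if "i \<in> N" for i using that by (auto simp: w_def N_def)
  have w_uminus: "w (- i) = - w i" if "i \<in> signed_dom n" for i
    using that w_neg w_pos[of i] w_neg[of "- i"] w_pos[of "- i"] unfolding dom_split by force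
  have w_abs: "\<bar>w i\<bar> = \<bar>u (- \<bar>i\<bar>)\<bar>" "- \<bar>i\<bar> \<in> N" if "i \<in> signed_dom n" for i
    using that w_neg[of i] w_pos[of "- i"] unfolding dom_split by (auto simp: N_def)
  have w_dom: "w i \<in> signed_dom n" if "i \<in> signed_dom n" for i
    using w_abs[OF that] u_dom[of "- \<bar>i\<bar>"] by (auto simp: signed_dom_iff)
  have "inj_on w (signed_dom n)"
  proof (rule inj_onI)
    fix i k assume ik: "i \<in> signed_dom n" "k \<in> signed_dom n" "w i = w k"
    then have "\<bar>i\<bar> = \<bar>k\<bar>" using w_abs[OF ik(1)] w_abs[OF ik(2)] u_inj[of "- \<bar>i\<bar>" "- \<bar>k\<bar>"] by simp
    moreover have "i \<noteq> - k"
    proof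
      assume "i = - k"
      then have "w k = 0" using w_uminus[OF ik(2)] ik(3) by simp
      then show False using w_dom[OF ik(2)] by (simp add: signed_dom_iff)
    qed
    ultimately show "i = k" by (simp add: abs_eq_iff)
  qed
  then have "bij_betw w (signed_dom n) (signed_dom n)"
    using w_dom by (simp add: bij_betw_def endo_inj_surj signed_dom_def image_subset_iff)
  then have perm: "w \<in> signed_perms n"
    using w_uminus by (auto simp: signed_perms_def w_def dom_split)
  moreover have "quadrant_avoids r n w"
    unfolding quadrant_avoids_def
  proof (intro ballI impI)
    fix a b assume ab: "a \<in> signed_dom n" "b \<in> signed_dom n" "a < b \<and> b < 0 \<and> w a < 0 \<and> w b < 0"
    then have "a \<in> N" "b \<in> N" by (auto simp: signed_dom_iff N_def)
    then have "a \<in> C" "b \<in> C" using ab u_sign w_neg by auto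
    then show "\<not> r (w a) (w b)" using f(2) ab w_neg[OF \<open>a \<in> N\<close>] w_neg[OF \<open>b \<in> N\<close>] by (simp add: u_def)
  qed
  moreover have "fold_quadrants n w = M"
  proof (rule set_eqI)
    fix p :: "int \<times> int"
    obtain x y where p: "p = (x, y)" by (cases p)
    consider "x \<in> N" | "x = 0" | "x \<notin> {- int n..0}" by (force simp: N_def)
    then have "(x, y) \<in> fold_quadrants n w \<longleftrightarrow> (x, y) \<in> M"
    proof cases
      case 1
      then have "x \<in> signed_dom n" "x < 0" by (auto simp: N_def signed_dom_iff)
      then show ?thesis using u_col[OF 1, of y] w_neg[OF 1] fold_quadrants_column by metis
    next
      case 2
      have "(0, y) \<in> fold_quadrants n w \<longleftrightarrow> (\<exists>x\<in>C. y = - u x)"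
        unfolding fold_quadrants_column_0
      proof
        assume "\<exists>i\<in>{1..int n}. 0 < w i \<and> y = w i"
        then obtain i where i: "i \<in> {1..int n}" "0 < w i" "y = w i" by blast
        then have "- i \<in> N" by (simp add: N_def)
        then have "- i \<in> C \<and> y = - u (- i)" using i w_pos[of "- i"] u_sign[of "- i"] by simp
        then show "\<exists>x\<in>C. y = - u x" by blast
      next
        assume "\<exists>x\<in>C. y = - u x"
        then obtain x where x: "x \<in> C" "y = - u x" by blast
        then have "x \<in> N" using C by blast
        then show "\<exists>i\<in>{1..int n}. 0 < w i \<and> y = w i"
          using x w_pos[of x] uC(2)[of x] by (intro bexI[of _ "- x"]) (auto simp: N_def)
      qed
      also have "\<dots> \<longleftrightarrow> - y \<in> f ` C"
        by (auto simp: u_def image_iff equation_minus_iff minus_equation_iff[of y] eq_commute)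
      also have "\<dots> \<longleftrightarrow> (0, y) \<in> M"
        using f(1) by (simp add: bij_betw_def R_def)
      finally show ?thesis using 2 by simp
    next
      case 3
      have "fold_quadrants n w \<in> fillings n (card {i \<in> {1..int n}. w i > 0})"
        using fold_quadrants_fillings[OF perm] by simp
      then show ?thesis using 3 fillings_bounds[OF M, of x y] fillings_bounds[of _ n _ x y] by auto
    qed
    then show "p \<in> fold_quadrants n w \<longleftrightarrow> p \<in> M" using p by simp
  qed
  ultimately show ?thesis by blast
qed

text \<open>\<open>fold_quadrants n\<close> is a bijection between the two sets. For surjectivity,
  the preimage with \<open>quadrant_avoids\<close> is taken: it avoids the pattern by
  \<open>split_pattern_fold\<close>, and its number of positive entries is read off from column
  0.\<close>

lemma card_signed_avoiders:
  assumes r: "r = (<) \<or> r = (>)"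
  shows "card {w \<in> signed_perms n. \<not> split_pattern r r (signed_graph n w) \<and> card {i \<in> {1..int n}. w i > 0} = j}
    = card {M \<in> fillings n j. \<not> split_pattern r r M}" (is "card ?W = card ?F")
proof (rule bij_betw_same_card)
  have "inj_on (fold_quadrants n) ?W"
  proof (rule inj_onI)
    fix w w' assume "w \<in> ?W" "w' \<in> ?W" "fold_quadrants n w = fold_quadrants n w'"
    then show "w = w'"
      using fold_quadrants_inj[of w n r w'] quadrant_avoids_if_avoids[OF _ r] r by simp
  qed
  moreover have "fold_quadrants n ` ?W = ?F"
  proof
    show "fold_quadrants n ` ?W \<subseteq> ?F"
      using fold_quadrants_fillings split_pattern_if_fold[OF r] by auto
    show "?F \<subseteq> fold_quadrants n ` ?W"
    proof
      fix M assume "M \<in> ?F"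
      then have M: "M \<in> fillings n j" "\<not> split_pattern r r M" by auto
      obtain w where w: "w \<in> signed_perms n" "quadrant_avoids r n w" "fold_quadrants n w = M"
        using fold_quadrants_surj[OF M(1) r] by blast
      have "card {y. (0, y) \<in> M} = j" using M(1) by (simp add: fillings_def)
      then have "card {i \<in> {1..int n}. w i > 0} = j"
        using card_fold_quadrants_column_0[OF w(1)] w(3) by simp
      moreover have "\<not> split_pattern r r (signed_graph n w)"
        using split_pattern_fold[OF w(1) r w(2)] w(3) M(2) by blast
      ultimately show "M \<in> fold_quadrants n ` ?W" using w by (intro rev_image_eqI[of w]) auto
    qed
  qed
  ultimately show "bij_betw (fold_quadrants n) ?W ?F" by (simp add: bij_betw_def)
qed

theorem theorem1p1:
  fixes n j :: nat
  assumes "n \<ge> 1" and "j \<le> n"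
  shows "card (B_avoid_j n j [1,2,3,4]) = card (B_avoid_j n j [2,1,4,3])"
proof -
  have "B_avoid_j n j [1,2,3,4] = {w \<in> signed_perms n. \<not> split_pattern (<) (<) (signed_graph n w)
      \<and> card {i \<in> {1..int n}. w i > 0} = j}"
    unfolding B_avoid_j_def B_avoid_def contains_pattern_1234 by blast
  moreover have "B_avoid_j n j [2,1,4,3] = {w \<in> signed_perms n. \<not> split_pattern (>) (>) (signed_graph n w)
      \<and> card {i \<in> {1..int n}. w i > 0} = j}"
    unfolding B_avoid_j_def B_avoid_def contains_pattern_2143 by blast
  ultimately show ?thesis
    using card_signed_avoiders[of "(<)" n j] card_signed_avoiders[of "(>)" n j]
      card_avoiders_12_34_eq_21_43 by simp
qed

end
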